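(* Let $G$ be a Hausdorff topological group and let $S\subseteq G$ be a subsemigroup of $G$ which is precompact in $G$. Then the closure $\overline{S}$ of $S$ in $G$ is a precompact subgroup of $G$.
   Context: A subsemigroup of a group $G$ is a nonempty subset $S\subseteq G$ with $SS\subseteq S$. A subset $A$ of a topological group $G$ with neutral element $e$ is precompact in $G$ if for every neighborhood $V$ of $e$ there exists a finite set $K\subseteq G$ such that $A\subseteq KV$ and $A\subseteq VK$. *)

theory Defs
  imports "HOL-Analysis.Abstract_Topological_Spaces" "HOL-Algebra.Coset"
begin

locale topological_group = group G for G :: "('a, 'b) monoid_scheme" (structure) +
  fixes T :: "'a topology"
  assumes topspace_eq_carrier: "topspace T = carrier G"
    and continuous_mult:
      "continuous_map (prod_topology T T) T (\<lambda>(x, y). x \<otimes> y)"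
    and continuous_inv: "continuous_map T T (\<lambda>x. inv x)"

definition subsemigroup :: "'a set \<Rightarrow> ('a, 'b) monoid_scheme \<Rightarrow> bool" where
  "subsemigroup S G \<longleftrightarrow>
     S \<noteq> {} \<and> S \<subseteq> carrier G \<and> S <#>\<^bsub>G\<^esub> S \<subseteq> S"

text \<open>Neighbourhoods need not be open.\<close>

definition neighbourhood_in :: "'a topology \<Rightarrow> 'a \<Rightarrow> 'a set \<Rightarrow> bool" where
  "neighbourhood_in T x V \<longleftrightarrow>
     V \<subseteq> topspace T \<and> (\<exists>U. openin T U \<and> x \<in> U \<and> U \<subseteq> V)"

definition precompact_in ::
    "('a, 'b) monoid_scheme \<Rightarrow> 'a topology \<Rightarrow> 'a set \<Rightarrow> bool" where
  "precompact_in G T A \<longleftrightarrow>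
     A \<subseteq> carrier G \<and>
     (\<forall>V. neighbourhood_in T \<one>\<^bsub>G\<^esub> V \<longrightarrow>
        (\<exists>K. finite K \<and> K \<subseteq> carrier G \<and>
             A \<subseteq> K <#>\<^bsub>G\<^esub> V \<and> A \<subseteq> V <#>\<^bsub>G\<^esub> K))"

end

theory Submission
  imports Defs
begin

text \<open>Among the odd powers of \<open>s \<in> S\<close>, precompactness and the pigeonhole principle yield two
  in a common translate \<open>kW\<close> of a small neighbourhood \<open>W\<close> of the neutral element. Their
  exponents differ by at least 2, so their quotient is \<open>s\<^sup>p\<^sup>+\<^sup>1\<close> with \<open>p \<ge> 1\<close>; it is close to the
  neutral element, which makes \<open>s\<^sup>p \<in> S\<close> close to the inverse of \<open>s\<close>. Hence the closure of \<open>S\<close>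
  contains the inverse of every element of \<open>S\<close>, and by continuity the inverse of each of its own
  elements. It is precompact because \<open>S \<subseteq> KW\<close> puts it inside \<open>SW \<subseteq> KWW\<close>, and symmetrically on
  the other side.\<close>

lemma neighbourhood_in_continuous_map_preimage:
  assumes "continuous_map X Y f" and "x \<in> topspace X" and "neighbourhood_in Y (f x) V"
  shows "neighbourhood_in X x {y \<in> topspace X. f y \<in> V}"
proof -
  obtain U where U: "openin Y U" "f x \<in> U" "U \<subseteq> V"
    using assms(3) by (auto simp: neighbourhood_in_def)
  then have "openin X {y \<in> topspace X. f y \<in> U}"
    using openin_continuous_map_preimage[OF assms(1)] by blast
  then show ?thesis
    using U assms(2) unfolding neighbourhood_in_def by blast
qed

lemma in_closure_of_neighbourhood_in:
  "x \<in> X closure_of A \<longleftrightarrow>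
     x \<in> topspace X \<and> (\<forall>V. neighbourhood_in X x V \<longrightarrow> (\<exists>y \<in> A. y \<in> V))"
  unfolding in_closure_of neighbourhood_in_def using openin_subset by (metis subsetD subset_refl)

lemma closure_of_meets_continuous_map_preimage:
  assumes x: "x \<in> X closure_of A" and f: "continuous_map X Y f"
    and V: "neighbourhood_in Y (f x) V"
  obtains y where "y \<in> A" "y \<in> topspace X" "f y \<in> V"
  using x neighbourhood_in_continuous_map_preimage[OF f _ V]
  unfolding in_closure_of_neighbourhood_in by blast

lemma continuous_map_diagonal_neighbourhood_in:
  assumes f: "continuous_map (prod_topology X X) Y f" and x: "x \<in> topspace X"
    and V: "neighbourhood_in Y (f (x, x)) V"
  obtains W where "neighbourhood_in X x W" "\<And>a b. a \<in> W \<Longrightarrow> b \<in> W \<Longrightarrow> f (a, b) \<in> V"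
proof -
  let ?P = "{z \<in> topspace (prod_topology X X). f z \<in> V}"
  have "neighbourhood_in (prod_topology X X) (x, x) ?P"
    using neighbourhood_in_continuous_map_preimage[OF f _ V] x by simp
  then obtain U where U: "openin (prod_topology X X) U" "(x, x) \<in> U" "U \<subseteq> ?P"
    unfolding neighbourhood_in_def by blast
  obtain A B where A: "openin X A" "x \<in> A" and B: "openin X B" "x \<in> B" and AB: "A \<times> B \<subseteq> U"
    using U(1,2) unfolding openin_prod_topology_alt by meson
  have "neighbourhood_in X x (A \<inter> B)"
    using A(2) B(2) openin_Int[OF A(1) B(1)] openin_subset[OF A(1)]
    unfolding neighbourhood_in_def by blast
  then show thesis
    using that AB U(3) by blast
qed

lemma (in monoid) nat_pow_in_subsemigroup:
  assumes "subsemigroup S G" and s: "s \<in> S" and "n > 0"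
  shows "s [^] (n::nat) \<in> S"
  using \<open>n > 0\<close>
proof (induction n rule: nat_induct_non_zero)
  case 1
  show ?case
    using assms by (auto simp: subsemigroup_def)
next
  case (Suc n)
  then have "s [^] Suc n \<in> S <#> S"
    using s by (auto simp: set_mult_def)
  then show ?case
    using assms(1) by (auto simp: subsemigroup_def)
qed

context topological_group
begin

lemma neighbourhood_in_subset_carrier: "neighbourhood_in T x V \<Longrightarrow> V \<subseteq> carrier G"
  by (simp add: neighbourhood_in_def topspace_eq_carrier)

lemma closure_of_subset_carrier: "T closure_of A \<subseteq> carrier G"
  using closure_of_subset_topspace[of T A] by (simp add: topspace_eq_carrier)

lemma continuous_map_mult:
  assumes "continuous_map X T f" and "continuous_map X T g"
  shows "continuous_map X T (\<lambda>x. f x \<otimes> g x)"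
  using continuous_map_compose[OF continuous_map_pairedI[OF assms] continuous_mult]
  by (simp add: o_def)

lemma continuous_map_m_inv:
  assumes "continuous_map X T f"
  shows "continuous_map X T (\<lambda>x. inv (f x))"
  using continuous_map_compose[OF assms continuous_inv] by (simp add: o_def)

lemma neighbourhood_in_one_square:
  assumes "neighbourhood_in T \<one> V"
  obtains W where "neighbourhood_in T \<one> W" "W <#> W \<subseteq> V"
proof -
  obtain W where "neighbourhood_in T \<one> W" "\<And>a b. a \<in> W \<Longrightarrow> b \<in> W \<Longrightarrow> a \<otimes> b \<in> V"
    using continuous_map_diagonal_neighbourhood_in[OF continuous_mult, of \<one> V] assms
    by (auto simp: topspace_eq_carrier)
  then show thesis
    using that unfolding set_mult_def by blast
qed

lemma neighbourhood_in_one_left_quotient: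
  assumes "neighbourhood_in T \<one> V"
  obtains W where "neighbourhood_in T \<one> W" "\<And>a b. a \<in> W \<Longrightarrow> b \<in> W \<Longrightarrow> inv a \<otimes> b \<in> V"
proof -
  have "continuous_map (prod_topology T T) T (\<lambda>z. inv (fst z) \<otimes> snd z)"
    by (intro continuous_map_mult continuous_map_m_inv continuous_map_fst continuous_map_snd)
  from continuous_map_diagonal_neighbourhood_in[OF this, of \<one> V] show thesis
    using that assms by (auto simp: topspace_eq_carrier)
qed

lemma closure_of_subset_set_mult_right:
  assumes V: "neighbourhood_in T \<one> V"
  shows "T closure_of A \<subseteq> A <#> V"
proof
  fix x assume x: "x \<in> T closure_of A"
  then have xG: "x \<in> carrier G"
    using closure_of_subset_carrier by blast
  have "continuous_map T T (\<lambda>y. inv y \<otimes> x)"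
    using xG by (intro continuous_map_mult continuous_inv) (simp add: topspace_eq_carrier)
  then obtain y where y: "y \<in> A" "y \<in> carrier G" "inv y \<otimes> x \<in> V"
    using closure_of_meets_continuous_map_preimage[OF x, of T "\<lambda>y. inv y \<otimes> x" V] V xG
    by (auto simp: topspace_eq_carrier)
  have "x = y \<otimes> (inv y \<otimes> x)"
    using xG y(2) by (simp flip: m_assoc)
  with y show "x \<in> A <#> V"
    unfolding set_mult_def by blast
qed

lemma closure_of_subset_set_mult_left:
  assumes V: "neighbourhood_in T \<one> V"
  shows "T closure_of A \<subseteq> V <#> A"
proof
  fix x assume x: "x \<in> T closure_of A"
  then have xG: "x \<in> carrier G"
    using closure_of_subset_carrier by blast
  have "continuous_map T T (\<lambda>y. x \<otimes> inv y)"
    using xG by (intro continuous_map_mult continuous_inv) (simp add: topspace_eq_carrier)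
  then obtain y where y: "y \<in> A" "y \<in> carrier G" "x \<otimes> inv y \<in> V"
    using closure_of_meets_continuous_map_preimage[OF x, of T "\<lambda>y. x \<otimes> inv y" V] V xG
    by (auto simp: topspace_eq_carrier)
  have "x = (x \<otimes> inv y) \<otimes> y"
    using xG y(2) by (simp add: m_assoc)
  with y show "x \<in> V <#> A"
    unfolding set_mult_def by blast
qed

lemma in_closure_of_set_multI:
  assumes A: "A \<subseteq> carrier G" and x: "x \<in> carrier G"
    and near: "\<And>V. neighbourhood_in T \<one> V \<Longrightarrow> x \<in> A <#> V"
  shows "x \<in> T closure_of A"
  unfolding in_closure_of_neighbourhood_in
proof (intro conjI allI impI)
  show "x \<in> topspace T"
    using x by (simp add: topspace_eq_carrier)
  fix U assume U: "neighbourhood_in T x U"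
  have "continuous_map T T (\<lambda>v. x \<otimes> inv v)"
    using x by (intro continuous_map_mult continuous_inv) (simp add: topspace_eq_carrier)
  then have "neighbourhood_in T \<one> {v \<in> carrier G. x \<otimes> inv v \<in> U}"
    using neighbourhood_in_continuous_map_preimage[of T T "\<lambda>v. x \<otimes> inv v" \<one> U] U x
    by (simp add: topspace_eq_carrier)
  from near[OF this] obtain a v where a: "a \<in> A" and v: "v \<in> carrier G" "x \<otimes> inv v \<in> U"
    and x_eq: "x = a \<otimes> v"
    unfolding set_mult_def by blast
  have "x \<otimes> inv v = a"
    using A a v(1) x_eq by (auto simp: m_assoc)
  with a v(2) show "\<exists>y \<in> A. y \<in> U"
    by blast
qed

lemma set_mult_closure_of_subset: "T closure_of A <#> T closure_of B \<subseteq> T closure_of (A <#> B)"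
proof -
  have image: "(\<lambda>(x, y). x \<otimes> y) ` (C \<times> D) = C <#> D" for C D
    by (auto simp: set_mult_def)
  show ?thesis
    using continuous_map_image_closure_subset[OF continuous_mult, of "A \<times> B"]
    by (simp only: closure_of_Times image)
qed

lemma precompact_in_sequence_recurrent:
  assumes A: "precompact_in G T A" and V: "neighbourhood_in T \<one> V" and x: "\<And>n. x n \<in> A"
  obtains m n :: nat where "n < m" "inv (x m) \<otimes> x n \<in> V"
proof -
  obtain W where W: "neighbourhood_in T \<one> W"
    and quotient: "\<And>a b. a \<in> W \<Longrightarrow> b \<in> W \<Longrightarrow> inv a \<otimes> b \<in> V"
    using neighbourhood_in_one_left_quotient[OF V] by blast
  obtain K where K: "finite K" "K \<subseteq> carrier G" "A \<subseteq> K <#> W"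
    using A W unfolding precompact_in_def by blast
  have "\<forall>n. \<exists>k \<in> K. x n \<in> k <# W"
    using x K(3) by (force simp: set_mult_def l_coset_def)
  then obtain k where k: "k \<in> K" and inf: "infinite {n. x n \<in> k <# W}"
    using pigeonhole_infinite_rel[of UNIV K "\<lambda>n k. x n \<in> k <# W"] K(1) by auto
  obtain n where n: "x n \<in> k <# W"
    using inf not_finite_existsD by blast
  obtain m where m: "n < m" "x m \<in> k <# W"
    using inf unfolding infinite_nat_iff_unbounded by blast
  obtain a b where a: "a \<in> W" "x n = k \<otimes> a" and b: "b \<in> W" "x m = k \<otimes> b"
    using n m(2) by (auto simp: l_coset_def)
  have carrier: "k \<in> carrier G" "a \<in> carrier G" "b \<in> carrier G"
    using k K(2) a(1) b(1) neighbourhood_in_subset_carrier[OF W] by auto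
  then have "inv k \<otimes> (k \<otimes> a) = a"
    by (simp flip: m_assoc)
  with carrier have "inv (x m) \<otimes> x n = inv b \<otimes> a"
    by (simp add: a(2) b(2) inv_mult_group m_assoc)
  then show thesis
    using that[OF m(1)] quotient[OF b(1) a(1)] by simp
qed

lemma inv_in_closure_of_precompact_subsemigroup:
  assumes S: "subsemigroup S G" and pre: "precompact_in G T S" and s: "s \<in> S"
  shows "inv s \<in> T closure_of S"
proof (rule in_closure_of_set_multI)
  show SG: "S \<subseteq> carrier G"
    using S by (simp add: subsemigroup_def)
  then have sG [simp]: "s \<in> carrier G"
    using s by blast
  then show "inv s \<in> carrier G"
    by simp
  fix V assume V: "neighbourhood_in T \<one> V"
  have "s [^] (2 * n + 1) \<in> S" for n :: nat
    using nat_pow_in_subsemigroup[OF S s, of "2 * n + 1"] by simp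
  then obtain m n :: nat where "n < m"
    and V_quotient: "inv (s [^] (2 * m + 1)) \<otimes> s [^] (2 * n + 1) \<in> V"
    using precompact_in_sequence_recurrent[OF pre V, of "\<lambda>n. s [^] (2 * n + 1)"] by blast
  define p r where "p = 2 * (m - n) - 1" and "r = 2 * n + 1"
  have "p > 0" and exponent: "2 * m + 1 = r + (1 + p)"
    using \<open>n < m\<close> by (auto simp: p_def r_def)
  have "s [^] (r + (1 + p)) = s [^] r \<otimes> (s \<otimes> s [^] p)"
    unfolding nat_pow_mult[OF sG, symmetric] by simp
  then have "inv (s [^] (r + (1 + p))) \<otimes> s [^] r = inv (s [^] p) \<otimes> inv s"
    by (simp add: inv_mult_group m_assoc)
  then have "inv s = s [^] p \<otimes> (inv (s [^] (r + (1 + p))) \<otimes> s [^] r)"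
    by (simp flip: m_assoc)
  moreover have "inv (s [^] (r + (1 + p))) \<otimes> s [^] r \<in> V"
    using V_quotient unfolding exponent r_def .
  ultimately show "inv s \<in> S <#> V"
    using nat_pow_in_subsemigroup[OF S s \<open>p > 0\<close>] unfolding set_mult_def by blast
qed

lemma subgroup_closure_of_precompact_subsemigroup:
  assumes S: "subsemigroup S G" and pre: "precompact_in G T S"
  shows "subgroup (T closure_of S) G"
proof (rule subgroupI)
  show "T closure_of S \<subseteq> carrier G"
    by (rule closure_of_subset_carrier)
  have "S \<noteq> {}" "S \<subseteq> topspace T"
    using S by (auto simp: subsemigroup_def topspace_eq_carrier)
  then show "T closure_of S \<noteq> {}"
    using closure_of_subset by blast
next
  have "(\<lambda>x. inv x) ` S \<subseteq> T closure_of S"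
    using inv_in_closure_of_precompact_subsemigroup[OF S pre] by blast
  then have "(\<lambda>x. inv x) ` (T closure_of S) \<subseteq> T closure_of S"
    using continuous_map_image_closure_subset[OF continuous_inv, of S]
      closure_of_minimal[OF _ closedin_closure_of] by (metis subset_trans)
  then show "inv x \<in> T closure_of S" if "x \<in> T closure_of S" for x
    using that by blast
next
  have "T closure_of S <#> T closure_of S \<subseteq> T closure_of S"
    using S set_mult_closure_of_subset[of S S] closure_of_mono[of "S <#> S" S T]
    by (auto simp: subsemigroup_def)
  then show "x \<otimes> y \<in> T closure_of S" if "x \<in> T closure_of S" "y \<in> T closure_of S" for x y
    using that by (auto simp: set_mult_def)
qed

lemma precompact_in_closure_of:
  assumes pre: "precompact_in G T A"
  shows "precompact_in G T (T closure_of A)"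
  unfolding precompact_in_def
proof (intro conjI allI impI)
  show "T closure_of A \<subseteq> carrier G"
    by (rule closure_of_subset_carrier)
  fix V assume "neighbourhood_in T \<one> V"
  then obtain W where W: "neighbourhood_in T \<one> W" "W <#> W \<subseteq> V"
    using neighbourhood_in_one_square by blast
  have WG: "W \<subseteq> carrier G"
    using W(1) by (rule neighbourhood_in_subset_carrier)
  obtain K where K: "finite K" "K \<subseteq> carrier G" "A \<subseteq> K <#> W" "A \<subseteq> W <#> K"
    using pre W(1) unfolding precompact_in_def by blast
  have "T closure_of A \<subseteq> A <#> W"
    using W(1) by (rule closure_of_subset_set_mult_right)
  also have "\<dots> \<subseteq> (K <#> W) <#> W"
    using K(3) by (rule mono_set_mult) simp
  also have "\<dots> = K <#> (W <#> W)"
    using K(2) WG by (simp add: set_mult_assoc)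
  also have "\<dots> \<subseteq> K <#> V"
    using W(2) by (intro mono_set_mult) simp_all
  finally have KV: "T closure_of A \<subseteq> K <#> V" .
  have "T closure_of A \<subseteq> W <#> A"
    using W(1) by (rule closure_of_subset_set_mult_left)
  also have "\<dots> \<subseteq> W <#> (W <#> K)"
    using K(4) by (intro mono_set_mult) simp_all
  also have "\<dots> = (W <#> W) <#> K"
    using K(2) WG by (simp add: set_mult_assoc)
  also have "\<dots> \<subseteq> V <#> K"
    using W(2) by (rule mono_set_mult) simp
  finally have "T closure_of A \<subseteq> V <#> K" .
  with K(1,2) KV show "\<exists>K. finite K \<and> K \<subseteq> carrier G \<and>
      T closure_of A \<subseteq> K <#> V \<and> T closure_of A \<subseteq> V <#> K"
    by blast
qed

end

theorem proposition2p4: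
  fixes G :: "('a, 'b) monoid_scheme" and T :: "'a topology" and S :: "'a set"
  assumes "topological_group G T"
    and "Hausdorff_space T"
    and "subsemigroup S G"
    and "precompact_in G T S"
  shows "subgroup (T closure_of S) G \<and> precompact_in G T (T closure_of S)"
proof
  interpret topological_group G T by (rule assms(1))
  show "subgroup (T closure_of S) G"
    using assms(3,4) by (rule subgroup_closure_of_precompact_subsemigroup)
  show "precompact_in G T (T closure_of S)"
    using assms(4) by (rule precompact_in_closure_of)
qed

end
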